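(* Assume that $\mathcal{D}$ is deterministic and that the best-in-class error is achieved by some $h^*\in\mathcal{H}$, i.e. $\mathbb{E}[\ell(h^*(x),y)]=\inf_{h\in\mathcal{H}}\mathbb{E}[\ell(h(x),y)]$. Let $p=\mathbb{P}[y=+1]$. Then the minimizability gap is null, $\mathcal{M}(\mathcal{H})=0$, if and only if $$\ell(h^*(x),+1)=\ell_+\ \text{ a.s. over }\mathcal{X}_+,\qquad \ell(h^*(x),-1)=\ell_-\ \text{ a.s. over }\mathcal{X}_-.$$ If further $\alpha\mapsto\ell(\alpha,+1)$ and $\alpha\mapsto\ell(\alpha,-1)$ are injective and $\ell_+=\ell(\alpha_+,+1)$, $\ell_-=\ell(\alpha_-,-1)$ for some $\alpha_+,\alpha_-\in A$, then the condition is equivalent to $h^*(x)=\alpha_+1_{x\in\mathcal{X}_+}+\alpha_-1_{x\in\mathcal{X}_-}$ a.s. Furthermore, for $\epsilon\ge0$, the minimizability gap is bounded by $\epsilon$, $\mathcal{M}(\mathcal{H})\le\epsilon$, if and only if $$p\left(\mathbb{E}[\ell(h^*(x),+1)\mid y=+1]-\ell_+\right)+(1-p)\left(\mathbb{E}[\ell(h^*(x),-1)\mid y=-1]-\ell_-\right)\le\epsilon.$$ In particular, this condition implies $\mathbb{E}[\ell(h^*(x),+1)\mid y=+1]-\ell_+\le\frac{\epsilon}{p}$ (when $p>0$) and $\mathbb{E}[\ell(h^*(x),-1)\mid y=-1]-\ell_-\le\frac{\epsilon}{1-p}$ (when $p<1$).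
   Context: Binary classification: input space $\mathcal{X}$, labels $\{-1,+1\}$, $\mathcal{D}$ a distribution over $\mathcal{X}\times\{-1,+1\}$; $\mathcal{H}$ is a family of measurable functions $h\colon\mathcal{X}\to\mathbb{R}$. The surrogate loss is pointwise: its value for $h$ at $(x,y)$ is $\ell(h(x),y)$, with $\ell\colon\mathbb{R}\times\{-1,+1\}\to\mathbb{R}_+$ measurable. It is assumed that the set $A=\{h(x)\colon h\in\mathcal{H}\}$ of predictor values at $x$ does not depend on $x\in\mathcal{X}$. $\mathcal{D}$ is deterministic if the conditional probabilities $\mathcal{D}(Y=y\mid X=x)$ are all $0$ or $1$; then $\mathcal{X}_+$ (resp. $\mathcal{X}_-$) is the subset of $\mathcal{X}$ over which the label is $+1$ (resp. $-1$). $\ell_+=\inf_{\alpha\in A}\ell(\alpha,+1)$, $\ell_-=\inf_{\alpha\in A}\ell(\alpha,-1)$. The minimizability gap is $\mathcal{M}(\mathcal{H})=\inf_{h\in\mathcal{H}}\mathbb{E}_{(x,y)\sim\mathcal{D}}[\ell(h(x),y)]-\mathbb{E}_x\left[\inf_{h\in\mathcal{H}}\mathbb{E}_y[\ell(h(x),y)\mid x]\right]$. Terms multiplied by a zero probability $p$ or $1-p$ are read as $0$. "a.s. over $\mathcal{X}_\pm$" refers to the marginal distribution of $x$. *)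

theory Defs
  imports "HOL-Probability.Probability"
begin

abbreviation label_space :: "int measure" where
  "label_space \<equiv> count_space {- 1, 1}"

definition marginal :: "'x measure \<Rightarrow> ('x \<times> int) measure \<Rightarrow> 'x measure" where
  "marginal M D = distr D M fst"

text \<open>\<open>K\<close> is a regular version of the conditional law of the label given the input,
  that is, \<open>K x {y}\<close> plays the role of \<open>D(Y = y | X = x)\<close>.\<close>

definition conditional_law ::
    "'x measure \<Rightarrow> ('x \<times> int) measure \<Rightarrow> ('x \<Rightarrow> int measure) \<Rightarrow> bool" where
  "conditional_law M D K \<longleftrightarrow>
     K \<in> M \<rightarrow>\<^sub>M prob_algebra label_space \<and>
     (\<forall>B\<in>sets M. \<forall>C\<in>sets label_space.
        emeasure D (B \<times> C) = (\<integral>\<^sup>+x\<in>B. emeasure (K x) C \<partial>marginal M D))"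

definition deterministic :: "'x measure \<Rightarrow> ('x \<Rightarrow> int measure) \<Rightarrow> bool" where
  "deterministic M K \<longleftrightarrow> (\<forall>x\<in>space M. \<forall>y\<in>{- 1, 1}. measure (K x) {y} \<in> {0, 1})"

definition label_region :: "'x measure \<Rightarrow> ('x \<Rightarrow> int measure) \<Rightarrow> int \<Rightarrow> 'x set" where
  "label_region M K y = {x \<in> space M. measure (K x) {y} = 1}"

text \<open>The loss is nonnegative but no integrability is assumed, so expectations are
  nonnegative Lebesgue integrals. They are moved to \<^typ>\<open>ereal\<close> because subtraction
  on \<^typ>\<open>ennreal\<close> truncates at zero.\<close>

definition expected_loss ::
    "('x \<times> int) measure \<Rightarrow> (real \<Rightarrow> int \<Rightarrow> real) \<Rightarrow> ('x \<Rightarrow> real) \<Rightarrow> ereal" where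
  "expected_loss D l h = enn2ereal (\<integral>\<^sup>+(x, y). ennreal (l (h x) y) \<partial>D)"

definition conditional_loss ::
    "('x \<Rightarrow> int measure) \<Rightarrow> (real \<Rightarrow> int \<Rightarrow> real) \<Rightarrow> ('x \<Rightarrow> real) \<Rightarrow> 'x \<Rightarrow> ennreal" where
  "conditional_loss K l h x = (\<integral>\<^sup>+y. ennreal (l (h x) y) \<partial>K x)"

definition minimizability_gap ::
    "'x measure \<Rightarrow> ('x \<times> int) measure \<Rightarrow> ('x \<Rightarrow> int measure) \<Rightarrow>
     (real \<Rightarrow> int \<Rightarrow> real) \<Rightarrow> ('x \<Rightarrow> real) set \<Rightarrow> ereal" where
  "minimizability_gap M D K l H =
     (INF h\<in>H. expected_loss D l h)
     - enn2ereal (\<integral>\<^sup>+x. (INF h\<in>H. conditional_loss K l h x) \<partial>marginal M D)"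

definition inf_loss :: "(real \<Rightarrow> int \<Rightarrow> real) \<Rightarrow> real set \<Rightarrow> int \<Rightarrow> real" where
  "inf_loss l A y = (INF \<alpha>\<in>A. l \<alpha> y)"

definition label_event :: "('x \<times> int) measure \<Rightarrow> int \<Rightarrow> ('x \<times> int) set" where
  "label_event D y = {z \<in> space D. snd z = y}"

text \<open>The expectation of \<open>l (h x) y\<close> conditional on the event that the label is \<open>y\<close>;
  only meaningful if this event has positive probability.\<close>

definition class_loss ::
    "('x \<times> int) measure \<Rightarrow> (real \<Rightarrow> int \<Rightarrow> real) \<Rightarrow> ('x \<Rightarrow> real) \<Rightarrow> int \<Rightarrow> ereal" where
  "class_loss D l h y =
     enn2ereal (\<integral>\<^sup>+z. ennreal (l (h (fst z)) y) \<partial>uniform_measure D (label_event D y))"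

end

theory Submission
  imports Defs
begin

text \<open>Almost surely the label \<open>y\<close> is the one determined by the input \<open>x\<close>, so both terms
  of the gap split over the two label regions: the first is the integral of \<open>l (hs x) y\<close> and,
  because the set of predictor values is the same at every input, the second is the integral of
  the constant \<open>inf_loss l A y\<close>. The gap is therefore the sum over both labels of the
  integral of the pointwise excess \<open>l (hs x) y - inf_loss l A y \<ge> 0\<close>. This sum vanishes
  iff the excess vanishes almost everywhere, and conditioning on the label turns it into the
  weighted sum of the class-conditional excesses.\<close>

section \<open>Infima and cancellation in the extended reals\<close>

lemma INF_ennreal:
  assumes "I \<noteq> {}" "\<And>i. i \<in> I \<Longrightarrow> 0 \<le> f i"
  shows "(INF i\<in>I. ennreal (f i)) = ennreal (INF i\<in>I. f i)"
proof (rule antisym)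
  have bdd: "bdd_below (f ` I)"
    using assms(2) by (auto intro!: bdd_belowI[of _ 0])
  show "ennreal (INF i\<in>I. f i) \<le> (INF i\<in>I. ennreal (f i))"
    by (intro INF_greatest ennreal_leI cINF_lower bdd)
  show "(INF i\<in>I. ennreal (f i)) \<le> ennreal (INF i\<in>I. f i)"
  \<comment> \<open>Since \<open>I\<close> is nonempty, some index comes within \<open>e\<close> of
    the real infimum, and its value bounds the extended infimum. For empty \<open>I\<close> the left
    side would be \<open>top\<close>.\<close>
  proof (rule ennreal_le_epsilon)
    fix e :: real assume "0 < e"
    then have "(INF i\<in>I. f i) < (INF i\<in>I. f i) + e" by simp
    then obtain i where i: "i \<in> I" "f i < (INF i\<in>I. f i) + e"
      using cINF_less_iff[OF assms(1) bdd] by blast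
    have "0 \<le> (INF i\<in>I. f i)"
      using assms by (intro cINF_greatest)
    have "(INF i\<in>I. ennreal (f i)) \<le> ennreal (f i)"
      using i by (intro INF_lower)
    also have "\<dots> \<le> ennreal ((INF i\<in>I. f i) + e)"
      using i by (intro ennreal_leI) simp
    also have "\<dots> = ennreal (INF i\<in>I. f i) + ennreal e"
      using \<open>0 < e\<close> \<open>0 \<le> (INF i\<in>I. f i)\<close> by (simp add: ennreal_plus)
    finally show "(INF i\<in>I. ennreal (f i)) \<le> ennreal (INF i\<in>I. f i) + ennreal e" .
  qed
qed

text \<open>Only finite reals are subtracted, so cancellation survives infinite \<open>a\<close> or
  \<open>b\<close>. These stand for excess integrals, which may diverge because no integrability is
  assumed.\<close>

lemma ereal_add_diff_add_cancel:
  fixes a b :: ereal and c d :: real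
  assumes "0 \<le> a" "0 \<le> b"
  shows "(a + ereal c) + (b + ereal d) - (ereal c + ereal d) = a + b"
  using assms by (cases a; cases b) auto

section \<open>Deterministic labels and the two label regions\<close>

locale deterministic_distribution = prob_space D
  for D :: "('x \<times> int) measure" +
  fixes M :: "'x measure" and K :: "'x \<Rightarrow> int measure"
  assumes sets_D: "sets D = sets (M \<Otimes>\<^sub>M label_space)"
    and law: "conditional_law M D K"
    and det: "deterministic M K"
begin

abbreviation "region \<equiv> label_region M K"

lemma space_D: "space D = space M \<times> {- 1, 1}"
  using sets_eq_imp_space_eq[OF sets_D] by (simp add: space_pair_measure)

lemma fst_measurable [measurable]: "fst \<in> D \<rightarrow>\<^sub>M M"
  using measurable_cong_sets[OF sets_D refl] by auto

lemma snd_measurable [measurable]: "snd \<in> D \<rightarrow>\<^sub>M label_space"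
  using measurable_cong_sets[OF sets_D refl] by auto

lemma sets_marginal [simp, measurable_cong]: "sets (marginal M D) = sets M"
  by (simp add: marginal_def)

lemma space_marginal [simp]: "space (marginal M D) = space M"
  by (simp add: marginal_def)

lemma prob_space_marginal: "prob_space (marginal M D)"
  unfolding marginal_def by (rule prob_space_distr) measurable

lemma K_measurable: "K \<in> M \<rightarrow>\<^sub>M prob_algebra label_space"
  using law by (simp add: conditional_law_def)

lemma
  assumes "x \<in> space M"
  shows prob_space_K: "prob_space (K x)" and sets_K: "sets (K x) = sets label_space"
  using measurable_space[OF K_measurable assms] by (auto simp: space_prob_algebra)

lemma sets_label_region [measurable]:
  assumes "y \<in> {- 1, 1}"
  shows "region y \<in> sets M"
proof -
  have [measurable]: "K \<in> M \<rightarrow>\<^sub>M subprob_algebra label_space"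
    using K_measurable by (rule measurable_prob_algebraD)
  have [measurable]: "{y} \<in> sets label_space"
    using assms by auto
  have "(\<lambda>x. measure (K x) {y}) \<in> borel_measurable M"
    by measurable
  then show ?thesis
    unfolding label_region_def by measurable
qed

lemma measure_K_add:
  assumes "x \<in> space M"
  shows "measure (K x) {1} + measure (K x) {- 1} = 1"
proof -
  interpret K: prob_space "K x" by (rule prob_space_K[OF assms])
  have sp: "space (K x) = {- 1, 1}"
    using sets_eq_imp_space_eq[OF sets_K[OF assms]] by simp
  have "measure (K x) ({1} \<union> {- 1}) = measure (K x) {1} + measure (K x) {- 1}"
    by (rule K.finite_measure_Union) (auto simp: sets_K[OF assms])
  moreover have "{1} \<union> {- 1} = space (K x)"
    using sp by auto
  ultimately show ?thesis
    using K.prob_space by simp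
qed

text \<open>The two conditional probabilities sum to 1 and determinism allows only 0 and 1, so
  exactly one of them is 1: the regions partition \<open>space M\<close>.\<close>

lemma label_region_minus:
  assumes "x \<in> space M"
  shows "x \<in> region (- 1) \<longleftrightarrow> x \<notin> region 1"
  using measure_K_add[OF assms] det assms
  by (auto simp: label_region_def deterministic_def)

text \<open>On \<open>region y\<close> the conditional law gives no mass to the opposite label
  \<open>- y\<close>. Integrating this over the region shows that mismatched pairs form a null
  set.\<close>

lemma AE_fst_mem_label_region: "AE z in D. fst z \<in> region (snd z)"
proof -
  have null: "AE z in D. \<not> (fst z \<in> region y \<and> snd z = - y)" if y: "y \<in> {- 1, 1}" for y
  proof -
    have "emeasure (K x) {- y} = 0" if "x \<in> region y" for x
    proof -
      have x: "x \<in> space M" "measure (K x) {y} = 1"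
        using that by (auto simp: label_region_def)
      interpret K: prob_space "K x" by (rule prob_space_K[OF x(1)])
      show ?thesis
        using measure_K_add[OF x(1)] x(2) y by (auto simp: K.emeasure_eq_measure)
    qed
    then have "(\<integral>\<^sup>+x\<in>region y. emeasure (K x) {- y} \<partial>marginal M D) = (\<integral>\<^sup>+x. 0 \<partial>marginal M D)"
      by (intro nn_integral_cong) (simp split: split_indicator)
    \<comment> \<open>This is the defining identity of the conditional law for the rectangle with
      sides \<open>region y\<close> and \<open>{- y}\<close>.\<close>
    then have "emeasure D (region y \<times> {- y}) = 0"
      using law y sets_label_region[OF y] unfolding conditional_law_def by auto
    moreover have "region y \<times> {- y} \<in> sets D"
      unfolding sets_D using y sets_label_region[OF y] by (intro pair_measureI) auto
    ultimately have "region y \<times> {- y} \<in> null_sets D" by auto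
    from AE_not_in[OF this] show ?thesis
      by eventually_elim (simp add: mem_Times_iff)
  qed
  have "AE z in D. z \<in> space D"
    by (rule AE_space)
  with null[of 1, simplified] null[of "- 1", simplified] show ?thesis
  proof eventually_elim
    case (elim z)
    \<comment> \<open>The input is not in the region of the label opposite to its own, so by the
      partition it lies in the region of its label.\<close>
    then show ?case
      using label_region_minus[of "fst z"] by (auto simp: space_D mem_Times_iff)
  qed
qed

lemma AE_mem_label_region_iff:
  assumes "y \<in> {- 1, 1}"
  shows "AE z in D. snd z = y \<longleftrightarrow> fst z \<in> region y"
  using AE_fst_mem_label_region AE_space
proof eventually_elim
  case (elim z)
  then show ?case
    using label_region_minus[of "fst z"] assms by (auto simp: space_D mem_Times_iff)
qed

text \<open>Up to a null set the label event is the preimage of \<open>region y\<close> under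
  \<open>fst\<close>, so the integrand depends on the input alone and can be pushed forward to the
  marginal.\<close>

lemma nn_integral_label_event:
  assumes "y \<in> {- 1, 1}" and [measurable]: "g \<in> borel_measurable M"
  shows "(\<integral>\<^sup>+z. g (fst z) * indicator (label_event D y) z \<partial>D) =
    (\<integral>\<^sup>+x. g x * indicator (region y) x \<partial>marginal M D)"
proof -
  note [measurable] = sets_label_region[OF assms(1)]
  have "(\<integral>\<^sup>+z. g (fst z) * indicator (label_event D y) z \<partial>D) =
      (\<integral>\<^sup>+z. g (fst z) * indicator (region y) (fst z) \<partial>D)"
    using AE_mem_label_region_iff[OF assms(1)] AE_space
    by (intro nn_integral_cong_AE, eventually_elim)
       (simp add: label_event_def indicator_def)
  then show ?thesis
    by (simp add: marginal_def nn_integral_distr)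
qed

lemma label_event_measurable [measurable]:
  assumes "y \<in> {- 1, 1}"
  shows "label_event D y \<in> sets D"
proof -
  have "label_event D y = snd -` {y} \<inter> space D"
    by (auto simp: label_event_def)
  then show ?thesis
    using measurable_sets[OF snd_measurable, of "{y}"] assms by simp
qed

lemma emeasure_label_event:
  assumes "y \<in> {- 1, 1}"
  shows "emeasure D (label_event D y) = emeasure (marginal M D) (region y)"
  using nn_integral_label_event[OF assms, of "\<lambda>_. 1"] label_event_measurable[OF assms]
    sets_label_region[OF assms]
  by simp

lemma measure_label_event_minus:
  "measure D (label_event D (- 1)) = 1 - measure D (label_event D 1)"
proof -
  have "label_event D (- 1) = space D - label_event D 1"
    by (auto simp: label_event_def space_D)
  then show ?thesis
    using prob_compl[OF label_event_measurable[of 1]] by simp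
qed

text \<open>At such an input \<open>K x\<close> is concentrated at \<open>y\<close>, so the
  conditional expectation is the loss at that label. This holds for every \<open>h\<close>, which
  permits taking the infimum over \<open>H\<close> afterwards.\<close>

lemma conditional_loss_label_region:
  assumes x: "x \<in> region y" and y: "y \<in> {- 1, 1}"
  shows "conditional_loss K l h x = ennreal (l (h x) y)"
proof -
  have M: "x \<in> space M" "measure (K x) {y} = 1"
    using x by (auto simp: label_region_def)
  interpret K: prob_space "K x" by (rule prob_space_K[OF M(1)])
  have "AE y' in K x. y' \<in> {y}"
    using M(2) by (rule K.AE_prob_1)
  then have "conditional_loss K l h x = (\<integral>\<^sup>+y'. ennreal (l (h x) y) \<partial>K x)"
    unfolding conditional_loss_def by (intro nn_integral_cong_AE) auto
  then show ?thesis
    by (simp add: K.emeasure_space_1)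
qed

end

section \<open>Surrogate loss and its pointwise excess\<close>

locale surrogate_minimization = deterministic_distribution D M K
  for D :: "('x \<times> int) measure" and M K +
  fixes H :: "('x \<Rightarrow> real) set" and A :: "real set" and l :: "real \<Rightarrow> int \<Rightarrow> real"
    and hs :: "'x \<Rightarrow> real"
  assumes H_measurable: "H \<subseteq> borel_measurable M"
    and predictor_values: "x \<in> space M \<Longrightarrow> {h x |h. h \<in> H} = A"
    and loss_measurable: "(\<lambda>(\<alpha>, y). l \<alpha> y) \<in> borel_measurable (borel \<Otimes>\<^sub>M label_space)"
    and loss_nonneg: "y \<in> {- 1, 1} \<Longrightarrow> 0 \<le> l \<alpha> y"
    and hs_mem: "hs \<in> H"
    and hs_optimal: "expected_loss D l hs = (INF h\<in>H. expected_loss D l h)"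
begin

text \<open>The difference is nonnegative on \<open>space M\<close> by \<open>inf_loss_le\<close>,
  so \<open>ennreal\<close> truncates nothing. The value may be \<open>top\<close>.\<close>

definition region_excess :: "int \<Rightarrow> ennreal" where
  "region_excess y =
    (\<integral>\<^sup>+x. ennreal (l (hs x) y - inf_loss l A y) * indicator (region y) x \<partial>marginal M D)"

lemma hs_values: "x \<in> space M \<Longrightarrow> hs x \<in> A"
  using predictor_values hs_mem by blast

lemma A_nonempty: "A \<noteq> {}"
  using prob_space.not_empty[OF prob_space_marginal] hs_values by auto

lemma bdd_below_loss: "y \<in> {- 1, 1} \<Longrightarrow> bdd_below ((\<lambda>\<alpha>. l \<alpha> y) ` A)"
  using loss_nonneg by (auto intro!: bdd_belowI[of _ 0])

lemma inf_loss_nonneg: "y \<in> {- 1, 1} \<Longrightarrow> 0 \<le> inf_loss l A y"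
  unfolding inf_loss_def using A_nonempty loss_nonneg by (intro cINF_greatest)

lemma inf_loss_le: "y \<in> {- 1, 1} \<Longrightarrow> x \<in> space M \<Longrightarrow> inf_loss l A y \<le> l (hs x) y"
  unfolding inf_loss_def using bdd_below_loss hs_values by (intro cINF_lower)

lemma loss_hs_measurable [measurable]:
  assumes "y \<in> {- 1, 1}"
  shows "(\<lambda>x. l (hs x) y) \<in> borel_measurable M"
proof -
  have "hs \<in> borel_measurable M"
    using H_measurable hs_mem by auto
  then have "(\<lambda>x. (hs x, y)) \<in> M \<rightarrow>\<^sub>M borel \<Otimes>\<^sub>M label_space"
    using assms by (intro measurable_Pair) auto
  from measurable_compose[OF this loss_measurable] show ?thesis by simp
qed

text \<open>As \<open>h\<close> ranges over \<open>H\<close>, \<open>h x\<close> ranges over the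
  same set \<open>A\<close> for every input, so the infimum depends on \<open>x\<close> only through
  its region.\<close>

lemma INF_conditional_loss:
  assumes "x \<in> region y" and y: "y \<in> {- 1, 1}"
  shows "(INF h\<in>H. conditional_loss K l h x) = ennreal (inf_loss l A y)"
proof -
  have "x \<in> space M"
    using assms by (simp add: label_region_def)
  then have A: "A = (\<lambda>h. h x) ` H"
    using predictor_values by blast
  have "(INF h\<in>H. conditional_loss K l h x) = (INF \<alpha>\<in>A. ennreal (l \<alpha> y))"
    unfolding A image_image by (simp add: conditional_loss_label_region[OF assms])
  also have "\<dots> = ennreal (inf_loss l A y)"
    unfolding inf_loss_def using A_nonempty loss_nonneg y by (intro INF_ennreal)
  finally show ?thesis .
qed

text \<open>Writing the loss as excess plus infimum gives two nonnegative summands, so the integral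
  splits even when it is infinite.\<close>

lemma nn_integral_region_loss:
  assumes y: "y \<in> {- 1, 1}"
  shows "(\<integral>\<^sup>+x. ennreal (l (hs x) y) * indicator (region y) x \<partial>marginal M D) =
    region_excess y + ennreal (inf_loss l A y) * emeasure D (label_event D y)"
proof -
  note [measurable] = sets_label_region[OF y] loss_hs_measurable[OF y]
  have "(\<integral>\<^sup>+x. ennreal (l (hs x) y) * indicator (region y) x \<partial>marginal M D) =
      (\<integral>\<^sup>+x. ennreal (l (hs x) y - inf_loss l A y) * indicator (region y) x
        + ennreal (inf_loss l A y) * indicator (region y) x \<partial>marginal M D)"
    using inf_loss_le[OF y] inf_loss_nonneg[OF y]
    by (intro nn_integral_cong) (auto simp flip: ennreal_plus split: split_indicator)
  also have "\<dots> = region_excess y + ennreal (inf_loss l A y) * emeasure D (label_event D y)"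
    unfolding region_excess_def emeasure_label_event[OF y]
    by (subst nn_integral_add) (auto simp: nn_integral_cmult_indicator)
  finally show ?thesis .
qed

section \<open>Splitting both terms of the gap over the labels\<close>

lemma expected_loss_hs:
  "expected_loss D l hs = enn2ereal
    ((region_excess 1 + ennreal (inf_loss l A 1) * emeasure D (label_event D 1)) +
     (region_excess (- 1) + ennreal (inf_loss l A (- 1)) * emeasure D (label_event D (- 1))))"
proof -
  have [measurable]: "label_event D 1 \<in> sets D" "label_event D (- 1) \<in> sets D"
    "(\<lambda>x. l (hs x) 1) \<in> borel_measurable M" "(\<lambda>x. l (hs x) (- 1)) \<in> borel_measurable M"
    by (auto intro: label_event_measurable loss_hs_measurable)
  have "(\<integral>\<^sup>+(x, y). ennreal (l (hs x) y) \<partial>D) =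
      (\<integral>\<^sup>+z. ennreal (l (hs (fst z)) 1) * indicator (label_event D 1) z
        + ennreal (l (hs (fst z)) (- 1)) * indicator (label_event D (- 1)) z \<partial>D)"
    \<comment> \<open>Every point of \<open>space D\<close> has label 1 or -1, so exactly one of the
      two indicators is 1.\<close>
    by (intro nn_integral_cong) (auto simp: space_D label_event_def indicator_def)
  also have "\<dots> = (\<integral>\<^sup>+z. ennreal (l (hs (fst z)) 1) * indicator (label_event D 1) z \<partial>D)
        + (\<integral>\<^sup>+z. ennreal (l (hs (fst z)) (- 1)) * indicator (label_event D (- 1)) z \<partial>D)"
    by (rule nn_integral_add) measurable
  finally show ?thesis
    unfolding expected_loss_def
    by (simp add: nn_integral_label_event[of _ "\<lambda>x. ennreal (l (hs x) _)"] nn_integral_region_loss)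
qed

text \<open>The infimum over a possibly uncountable \<open>H\<close> coincides pointwise with a step
  function, constant on each region, whose integral is explicit.\<close>

lemma nn_integral_INF_conditional_loss:
  "(\<integral>\<^sup>+x. (INF h\<in>H. conditional_loss K l h x) \<partial>marginal M D) =
    ennreal (inf_loss l A 1) * emeasure D (label_event D 1) +
    ennreal (inf_loss l A (- 1)) * emeasure D (label_event D (- 1))"
proof -
  have [measurable]: "region 1 \<in> sets M" "region (- 1) \<in> sets M"
    by (auto intro: sets_label_region)
  have "(\<integral>\<^sup>+x. (INF h\<in>H. conditional_loss K l h x) \<partial>marginal M D) =
    (\<integral>\<^sup>+x. ennreal (inf_loss l A 1) * indicator (region 1) x
      + ennreal (inf_loss l A (- 1)) * indicator (region (- 1)) x \<partial>marginal M D)"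
  proof (intro nn_integral_cong)
    fix x assume "x \<in> space (marginal M D)"
    then show "(INF h\<in>H. conditional_loss K l h x) =
      ennreal (inf_loss l A 1) * indicator (region 1) x
      + ennreal (inf_loss l A (- 1)) * indicator (region (- 1)) x"
      using label_region_minus[of x]
      by (cases "x \<in> region 1") (auto simp: INF_conditional_loss)
  qed
  also have "\<dots> = (\<integral>\<^sup>+x. ennreal (inf_loss l A 1) * indicator (region 1) x \<partial>marginal M D)
      + (\<integral>\<^sup>+x. ennreal (inf_loss l A (- 1)) * indicator (region (- 1)) x \<partial>marginal M D)"
    by (rule nn_integral_add) measurable
  finally show ?thesis
    by (simp add: nn_integral_cmult_indicator emeasure_label_event)
qed

text \<open>Exhibits the terms to be subtracted as finite reals, the form that
  \<open>ereal_add_diff_add_cancel\<close> requires.\<close>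

lemma enn2ereal_inf_loss_mult:
  assumes "y \<in> {- 1, 1}"
  shows "enn2ereal (ennreal (inf_loss l A y) * emeasure D (label_event D y)) =
    ereal (inf_loss l A y * measure D (label_event D y))"
  using inf_loss_nonneg[OF assms]
  by (simp add: emeasure_eq_measure ennreal_mult[symmetric])

text \<open>Optimality of \<open>hs\<close> replaces the infimum of expected losses by its own loss;
  the constant parts of both terms then cancel.\<close>

lemma minimizability_gap_eq:
  "minimizability_gap M D K l H = enn2ereal (region_excess 1) + enn2ereal (region_excess (- 1))"
  unfolding minimizability_gap_def hs_optimal[symmetric] expected_loss_hs
    nn_integral_INF_conditional_loss plus_ennreal.rep_eq
  by (simp only: enn2ereal_inf_loss_mult insert_iff simp_thms
      ereal_add_diff_add_cancel enn2ereal_nonneg)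

text \<open>Conditioning divides the integral over the label event by its probability
  \<open>?q\<close>, so the class loss is the excess over \<open>?q\<close> plus the infimum.
  Multiplying by \<open>?q\<close> undoes the division.\<close>

lemma weighted_class_excess:
  assumes y: "y \<in> {- 1, 1}"
  shows "ereal (measure D (label_event D y)) * (class_loss D l hs y - ereal (inf_loss l A y)) =
    enn2ereal (region_excess y)"
proof -
  let ?q = "measure D (label_event D y)"
  note [measurable] = loss_hs_measurable[OF y] label_event_measurable[OF y]
  let ?I = "region_excess y + ennreal (inf_loss l A y) * ennreal ?q"
  have "(\<integral>\<^sup>+z. ennreal (l (hs (fst z)) y) \<partial>uniform_measure D (label_event D y)) = ?I / ennreal ?q"
    using nn_integral_label_event[OF y, of "\<lambda>x. ennreal (l (hs x) y)"]
    by (simp add: nn_integral_uniform_measure nn_integral_region_loss[OF y] emeasure_eq_measure)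
  then have cl: "class_loss D l hs y = enn2ereal (?I / ennreal ?q)"
    by (simp add: class_loss_def)
  show ?thesis
  \<comment> \<open>For \<open>?q = 0\<close> the left side is 0 because 0 times anything is 0 in
    \<open>ereal\<close>, and the excess is an integral over a null set.\<close>
  proof (cases "?q = 0")
    case True
    then have null: "region y \<in> null_sets (marginal M D)"
      using emeasure_label_event[OF y] sets_label_region[OF y]
      by (auto simp: emeasure_eq_measure)
    have "region_excess y = (\<integral>\<^sup>+x. 0 \<partial>marginal M D)"
      unfolding region_excess_def using AE_not_in[OF null] by (intro nn_integral_cong_AE) auto
    then show ?thesis
      using True by (simp add: zero_ereal_def[symmetric] zero_ennreal.rep_eq)
  next
    case False
    then have q: "0 < ?q"
      by (simp add: less_le)
    show ?thesis
    proof (cases "region_excess y" rule: ennreal_cases)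
      case (real r)
      then have "?I / ennreal ?q = ennreal ((r + inf_loss l A y * ?q) / ?q)"
        using q inf_loss_nonneg[OF y]
        by (simp add: ennreal_mult[symmetric] divide_ennreal flip: ennreal_plus)
      then have "class_loss D l hs y = ereal ((r + inf_loss l A y * ?q) / ?q)"
        using q inf_loss_nonneg[OF y] real(1) by (simp add: cl)
      then show ?thesis
        using q real by (simp add: field_simps)
    next
      \<comment> \<open>The class loss is then infinite, and remains so after subtracting a finite
        real and multiplying by \<open>?q > 0\<close>.\<close>
      case top
      then have "class_loss D l hs y = \<infinity>"
        using q by (simp add: cl ennreal_top_divide)
      then show ?thesis
        using q top by simp
    qed
  qed
qed

section \<open>When the excess vanishes\<close>

lemma region_excess_eq_0_iff:
  assumes y: "y \<in> {- 1, 1}"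
  shows "region_excess y = 0 \<longleftrightarrow>
    (AE x in marginal M D. x \<in> region y \<longrightarrow> l (hs x) y = inf_loss l A y)"
proof -
  note [measurable] = sets_label_region[OF y] loss_hs_measurable[OF y]
  have "region_excess y = 0 \<longleftrightarrow>
    (AE x in marginal M D. ennreal (l (hs x) y - inf_loss l A y) * indicator (region y) x = 0)"
    unfolding region_excess_def by (intro nn_integral_0_iff_AE) measurable
  \<comment> \<open>\<open>ennreal\<close> sends every nonpositive real to 0, so vanishing gives
    only one inequality; the other is \<open>inf_loss_le\<close>.\<close>
  also have "\<dots> \<longleftrightarrow> (AE x in marginal M D. x \<in> region y \<longrightarrow> l (hs x) y = inf_loss l A y)"
    using inf_loss_le[OF y]
    by (intro AE_cong) (auto simp: ennreal_eq_0_iff label_region_def indicator_def intro: antisym)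
  finally show ?thesis .
qed

text \<open>Injectivity turns equality with an attained infimum into equality of predictor values.
  By the partition exactly one indicator is 1, so the two conditions merge into one formula.\<close>

lemma optimal_iff_values:
  assumes inj: "inj (\<lambda>\<alpha>. l \<alpha> 1)" "inj (\<lambda>\<alpha>. l \<alpha> (- 1))"
    and eq: "inf_loss l A 1 = l \<alpha>p 1" "inf_loss l A (- 1) = l \<alpha>m (- 1)"
  shows "((AE x in marginal M D. x \<in> region 1 \<longrightarrow> l (hs x) 1 = inf_loss l A 1) \<and>
      (AE x in marginal M D. x \<in> region (- 1) \<longrightarrow> l (hs x) (- 1) = inf_loss l A (- 1))) \<longleftrightarrow>
    (AE x in marginal M D. hs x = \<alpha>p * indicator (region 1) x + \<alpha>m * indicator (region (- 1)) x)"
proof -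
  have "l (hs x) 1 = l \<alpha>p 1 \<longleftrightarrow> hs x = \<alpha>p" "l (hs x) (- 1) = l \<alpha>m (- 1) \<longleftrightarrow> hs x = \<alpha>m" for x
    using injD[OF inj(1), of "hs x" \<alpha>p] injD[OF inj(2), of "hs x" \<alpha>m] by auto
  then show ?thesis
    unfolding AE_conj_iff[symmetric] eq
    by (intro AE_cong) (use label_region_minus in \<open>auto simp: indicator_def\<close>)
qed

end

section \<open>From weighted to classwise bounds, and assembly\<close>

lemma ereal_le_divide_of_mult_le:
  fixes t :: ereal
  assumes "0 < q" "ereal q * t \<le> ereal e"
  shows "t \<le> ereal (e / q)"
  \<comment> \<open>An infinite \<open>t\<close> would make the product infinite as
    \<open>0 < q\<close>, against the finite bound; \<open>t = -\<infinity>\<close> is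
    trivial.\<close>
  using assms by (cases t) (auto simp: field_simps)

theorem theorem16:
  fixes M :: "'x measure"
    and D :: "('x \<times> int) measure"
    and K :: "'x \<Rightarrow> int measure"
    and H :: "('x \<Rightarrow> real) set"
    and A :: "real set"
    and l :: "real \<Rightarrow> int \<Rightarrow> real"
    and hs :: "'x \<Rightarrow> real"
    and p :: real
  assumes "prob_space D"
    and "sets D = sets (M \<Otimes>\<^sub>M label_space)"
    and "conditional_law M D K"
    and "deterministic M K"
    and "H \<subseteq> borel_measurable M"
    and "\<And>x. x \<in> space M \<Longrightarrow> {h x |h. h \<in> H} = A"
    and "(\<lambda>(\<alpha>, y). l \<alpha> y) \<in> borel_measurable (borel \<Otimes>\<^sub>M label_space)"
    and "\<And>\<alpha> y. y \<in> {- 1, 1} \<Longrightarrow> 0 \<le> l \<alpha> y"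
    and "hs \<in> H"
    and "expected_loss D l hs = (INF h\<in>H. expected_loss D l h)"
    and "p = measure D (label_event D 1)"
  defines "gap \<equiv> minimizability_gap M D K l H"
    and "optimal \<equiv>
      (AE x in marginal M D. x \<in> label_region M K 1 \<longrightarrow> l (hs x) 1 = inf_loss l A 1) \<and>
      (AE x in marginal M D. x \<in> label_region M K (- 1) \<longrightarrow> l (hs x) (- 1) = inf_loss l A (- 1))"
    and "excess \<equiv>
      ereal p * (class_loss D l hs 1 - ereal (inf_loss l A 1)) +
      ereal (1 - p) * (class_loss D l hs (- 1) - ereal (inf_loss l A (- 1)))"
  shows "(gap = 0 \<longleftrightarrow> optimal) \<and>
    (\<forall>\<alpha>p\<in>A. \<forall>\<alpha>m\<in>A.
      inj (\<lambda>\<alpha>. l \<alpha> 1) \<longrightarrow> inj (\<lambda>\<alpha>. l \<alpha> (- 1)) \<longrightarrow>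
      inf_loss l A 1 = l \<alpha>p 1 \<longrightarrow> inf_loss l A (- 1) = l \<alpha>m (- 1) \<longrightarrow>
      (optimal \<longleftrightarrow>
        (AE x in marginal M D.
          hs x = \<alpha>p * indicator (label_region M K 1) x
               + \<alpha>m * indicator (label_region M K (- 1)) x))) \<and>
    (\<forall>\<epsilon>::real. 0 \<le> \<epsilon> \<longrightarrow>
      (gap \<le> ereal \<epsilon> \<longleftrightarrow> excess \<le> ereal \<epsilon>) \<and>
      (excess \<le> ereal \<epsilon> \<longrightarrow>
        (0 < p \<longrightarrow> class_loss D l hs 1 - ereal (inf_loss l A 1) \<le> ereal (\<epsilon> / p)) \<and>
        (p < 1 \<longrightarrow> class_loss D l hs (- 1) - ereal (inf_loss l A (- 1)) \<le> ereal (\<epsilon> / (1 - p)))))"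
proof -
  interpret prob_space D by fact
  interpret surrogate_minimization D M K H A l hs
    using assms by unfold_locales auto
  let ?e = "\<lambda>y. enn2ereal (region_excess y)"
  have gap: "gap = ?e 1 + ?e (- 1)"
    unfolding gap_def by (rule minimizability_gap_eq)
  have pos: "ereal p * (class_loss D l hs 1 - ereal (inf_loss l A 1)) = ?e 1"
    using weighted_class_excess[of 1] assms(11) by simp
  have neg: "ereal (1 - p) * (class_loss D l hs (- 1) - ereal (inf_loss l A (- 1))) = ?e (- 1)"
    using weighted_class_excess[of "- 1"] measure_label_event_minus assms(11) by simp
  have excess: "excess = ?e 1 + ?e (- 1)"
    unfolding excess_def pos neg ..
  have "gap = 0 \<longleftrightarrow> region_excess 1 = 0 \<and> region_excess (- 1) = 0"
    \<comment> \<open>Moved back to \<open>ennreal\<close>, a sum of two nonnegative terms is 0 only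
      if both are.\<close>
    unfolding gap by (simp flip: plus_ennreal.rep_eq zero_ennreal.rep_eq add: enn2ereal_inject)
  then have "gap = 0 \<longleftrightarrow> optimal"
    unfolding optimal_def by (simp add: region_excess_eq_0_iff)
  moreover have "optimal \<longleftrightarrow>
      (AE x in marginal M D. hs x = \<alpha>p * indicator (region 1) x + \<alpha>m * indicator (region (- 1)) x)"
    if "inj (\<lambda>\<alpha>. l \<alpha> 1)" "inj (\<lambda>\<alpha>. l \<alpha> (- 1))"
      "inf_loss l A 1 = l \<alpha>p 1" "inf_loss l A (- 1) = l \<alpha>m (- 1)" for \<alpha>p \<alpha>m
    unfolding optimal_def by (rule optimal_iff_values[OF that])
  moreover have
    "(0 < p \<longrightarrow> class_loss D l hs 1 - ereal (inf_loss l A 1) \<le> ereal (\<epsilon> / p)) \<and>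
     (p < 1 \<longrightarrow> class_loss D l hs (- 1) - ereal (inf_loss l A (- 1)) \<le> ereal (\<epsilon> / (1 - p)))"
    if "excess \<le> ereal \<epsilon>" for \<epsilon>
  proof -
    \<comment> \<open>Both weighted excesses are nonnegative, so each is bounded by their
      sum.\<close>
    have "?e 1 \<le> excess" "?e (- 1) \<le> excess"
      unfolding excess by (simp_all add: ereal_le_add_self ereal_le_add_self2)
    then have "?e 1 \<le> ereal \<epsilon>" "?e (- 1) \<le> ereal \<epsilon>"
      using that by auto
    then show ?thesis
      using ereal_le_divide_of_mult_le[of p] ereal_le_divide_of_mult_le[of "1 - p"]
      by (simp add: pos neg)
  qed
  \<comment> \<open>\<open>gap\<close> and \<open>excess\<close> unfold to the same sum, which
    settles the equivalence of the two bounds by \<epsilon>.\<close>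
  ultimately show ?thesis
    unfolding gap excess by blast
qed

end
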